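(* Let $(G,M,\Delta)$ be a Garside structure on a group $G$, let $n\ge 1$, and let $G_0=G,G_1,\dots,G_n$ and $H_1,\dots,H_n$ be two sequences of parabolic subgroups such that $G_{i+1},H_{i+1}\subset G_i$ and $(H_{i+1},G_{i+1})$ is a Dehornoy structure on $G_i$ for all $i\in\{0,1,\dots,n-1\}$, and $G_n\simeq\mathbb Z$. For each $i\in\{0,\dots,n-1\}$ let $P_i$ be the set of $(H_{i+1},G_{i+1})$-positive elements of $G_i$. Choose a generator $\alpha_n$ of $G_n$ and set $P_n=\{\alpha_n^k\mid k\ge 1\}$. For each $\epsilon=(\epsilon_0,\epsilon_1,\dots,\epsilon_n)\in\{\pm1\}^{n+1}$, the set $P^\epsilon=P_0^{\epsilon_0}\sqcup P_1^{\epsilon_1}\sqcup\cdots\sqcup P_n^{\epsilon_n}$ is the positive cone for a left-order on $G$.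
   Context: Left-orders. A left-order on a group $G$ is a total order invariant under left multiplication. A subset $P\subset G$ is the positive cone of a left-order $<$ if $PP\subset P$ and $G=P\sqcup P^{-1}\sqcup\{1\}$ (disjoint union), where $\alpha<\beta$ iff $\alpha^{-1}\beta\in P$. For a subset $P$ of a group, $P^{1}=P$ and $P^{-1}=\{\alpha^{-1}\mid\alpha\in P\}$. Garside structures. Let $G$ be a group and $M$ a submonoid with $M\cap M^{-1}=\{1\}$. For $\alpha,\beta\in G$: $\alpha\le_R\beta$ iff $\beta\alpha^{-1}\in M$, and $\alpha\le_L\beta$ iff $\alpha^{-1}\beta\in M$. An element $a\in M$ is balanced if $\{b\in M\mid b\le_R a\}=\{b\in M\mid b\le_L a\}$; this set is then denoted $\mathrm{Div}(a)$. For a balanced $\Delta\in M$, $(G,M,\Delta)$ is a Garside structure if: (a) $M$ is Noetherian, i.e. for each $a\in M$ there is $n\ge1$ such that $a$ is not a product of more than $n$ non-trivial elements of $M$; (b) $\mathrm{Div}(\Delta)$ is finite, generates $M$ as a monoid and $G$ as a group; (c) $(G,\le_R)$ is a lattice. An element $a\in M$ is unmovable if $\Delta\not\le_R a$. Every $\alpha\in G$ is uniquely $\alpha=a\Delta^k$ with $a\in M$ unmovable and $k\in\mathbb Z$ (the $\Delta$-form of $\alpha$). If $\delta\in M$ is balanced and $G_\delta$, $M_\delta$ are the subgroup of $G$ and the submonoid of $M$ generated by $\mathrm{Div}(\delta)$, then $(G_\delta,M_\delta,\delta)$ is a parabolic substructure if $\mathrm{Div}(\delta)=\mathrm{Div}(\Delta)\cap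 M_\delta$; then $G_\delta$ is a parabolic subgroup and $M_\delta$ a parabolic submonoid. The parabolic subgroup determines the substructure uniquely, and a parabolic substructure is itself a Garside structure. Dehornoy structure. Let $(G,M,\Delta)$ be a Garside structure with parabolic substructures $(H,N,\Lambda)$ and $(G_1,M_1,\Delta_1)$ such that $N\ne M$, $M_1\neq M$, $N\cup M_1$ generates $M$, $\Delta$ is central in $G$, and $\Delta_1$ is central in $G_1$. For a parabolic submonoid $K$ and $a\in M$, $\tau_K(a)$ denotes the unique $b\in K$ with $\{c\in K\mid c\le_R a\}=\{c\in K\mid c\le_R b\}$. Every $a\in M\setminus\{1\}$ is uniquely $a=a_p\cdots a_2a_1$ with $a_p\ne1$, $a_i=\tau_{M_1}(a_p\cdots a_i)$ for $i$ odd and $a_i=\tau_N(a_p\cdots a_i)$ for $i$ even; set $\mathrm{bh}(a)=p$ and $\mathrm{bh}(1)=1$. The depth is $\mathrm{dpt}(a)=(\mathrm{bh}(a)-1)/2$ if $\mathrm{bh}(a)$ is odd and $\mathrm{bh}(a)/2$ if $\mathrm{bh}(a)$ is even. An element $\alpha\in G$ with $\Delta$-form $\alpha=a\Delta^{-k}$ is $(H,G_1)$-negative if $k\ge1$ and $\mathrm{dpt}(a)<\mathrm{dpt}(\Delta^k)$; $\alpha$ is $(H,G_1)$-positive if $\alpha^{-1}$ is $(H,G_1)$-negative. Let $P$ be the set of $(H,G_1)$-positive elements; $P^{-1}$ is then the set of $(H,G_1)$-negative elements. The pair $(H,G_1)$ is a Dehornoy structure on $G$ if (a) $PP\subset P$,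 (b) $G_1PG_1\subset P$, (c) $G=P\sqcup P^{-1}\sqcup G_1$ (disjoint union). In the claim each $G_i$ is equipped with its Garside structure $(G_i,M_i,\Delta_i)$ as a parabolic subgroup, $(H_{i+1},G_{i+1})$ is a pair of parabolic subgroups of $G_i$ satisfying the assumptions of the previous paragraph with respect to $(G_i,M_i,\Delta_i)$, and positivity and the notion of Dehornoy structure are taken with respect to that structure. *)

theory Defs
  imports "HOL-Algebra.Algebra"
begin

definition left_order :: "('a, 'b) monoid_scheme \<Rightarrow> ('a \<times> 'a) set \<Rightarrow> bool" where
  "left_order G r \<longleftrightarrow>
     r \<subseteq> carrier G \<times> carrier G \<and>
     strict_linear_order_on (carrier G) r \<and>
     (\<forall>a \<in> carrier G. \<forall>b \<in> carrier G. \<forall>c \<in> carrier G.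
        (a, b) \<in> r \<longrightarrow> (c \<otimes>\<^bsub>G\<^esub> a, c \<otimes>\<^bsub>G\<^esub> b) \<in> r)"

definition positive_cone_of ::
  "('a, 'b) monoid_scheme \<Rightarrow> 'a set \<Rightarrow> ('a \<times> 'a) set \<Rightarrow> bool" where
  "positive_cone_of G P r \<longleftrightarrow>
     P \<subseteq> carrier G \<and>
     P <#>\<^bsub>G\<^esub> P \<subseteq> P \<and>
     carrier G = P \<union> set_inv\<^bsub>G\<^esub> P \<union> {\<one>\<^bsub>G\<^esub>} \<and>
     P \<inter> set_inv\<^bsub>G\<^esub> P = {} \<and> P \<inter> {\<one>\<^bsub>G\<^esub>} = {} \<and> set_inv\<^bsub>G\<^esub> P \<inter> {\<one>\<^bsub>G\<^esub>} = {} \<and>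
     (\<forall>a \<in> carrier G. \<forall>b \<in> carrier G. (a, b) \<in> r \<longleftrightarrow> inv\<^bsub>G\<^esub> a \<otimes>\<^bsub>G\<^esub> b \<in> P)"

text \<open>The set \<open>P\<close> raised to a sign \<open>e\<close>, where \<open>e\<close> is \<open>1\<close> or \<open>-1\<close>.\<close>

definition sign_set :: "('a, 'b) monoid_scheme \<Rightarrow> 'a set \<Rightarrow> int \<Rightarrow> 'a set" where
  "sign_set G P e = (if e = 1 then P else set_inv\<^bsub>G\<^esub> P)"

definition leR :: "('a, 'b) monoid_scheme \<Rightarrow> 'a set \<Rightarrow> 'a \<Rightarrow> 'a \<Rightarrow> bool" where
  "leR G M a b \<longleftrightarrow> b \<otimes>\<^bsub>G\<^esub> inv\<^bsub>G\<^esub> a \<in> M"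

definition leL :: "('a, 'b) monoid_scheme \<Rightarrow> 'a set \<Rightarrow> 'a \<Rightarrow> 'a \<Rightarrow> bool" where
  "leL G M a b \<longleftrightarrow> inv\<^bsub>G\<^esub> a \<otimes>\<^bsub>G\<^esub> b \<in> M"

definition balanced :: "('a, 'b) monoid_scheme \<Rightarrow> 'a set \<Rightarrow> 'a \<Rightarrow> bool" where
  "balanced G M a \<longleftrightarrow> {b \<in> M. leR G M b a} = {b \<in> M. leL G M b a}"

text \<open>Only meaningful for balanced \<open>a\<close>.\<close>

definition Div :: "('a, 'b) monoid_scheme \<Rightarrow> 'a set \<Rightarrow> 'a \<Rightarrow> 'a set" where
  "Div G M a = {b \<in> M. leR G M b a}"

definition submonoid_gen :: "('a, 'b) monoid_scheme \<Rightarrow> 'a set \<Rightarrow> 'a set" where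
  "submonoid_gen G A = \<Inter>{K. submonoid K G \<and> A \<subseteq> K}"

definition prod_of_list :: "('a, 'b) monoid_scheme \<Rightarrow> 'a list \<Rightarrow> 'a" where
  "prod_of_list G xs = foldr (\<lambda>x y. x \<otimes>\<^bsub>G\<^esub> y) xs \<one>\<^bsub>G\<^esub>"

definition noetherian_monoid :: "('a, 'b) monoid_scheme \<Rightarrow> 'a set \<Rightarrow> bool" where
  "noetherian_monoid G M \<longleftrightarrow>
     (\<forall>a \<in> M. \<exists>n::nat. n \<ge> 1 \<and>
        (\<forall>xs. set xs \<subseteq> M - {\<one>\<^bsub>G\<^esub>} \<and> prod_of_list G xs = a \<longrightarrow> length xs \<le> n))"

locale garside_structure = group G + submonoid M G
  for G (structure) and M +
  fixes \<Delta>
  assumes inter_inv: "M \<inter> set_inv M = {\<one>}"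
    and Delta_in: "\<Delta> \<in> M"
    and Delta_balanced: "balanced G M \<Delta>"
    and noetherian: "noetherian_monoid G M"
    and finite_Div: "finite (Div G M \<Delta>)"
    and Div_generates_monoid: "submonoid_gen G (Div G M \<Delta>) = M"
    and Div_generates_group: "generate G (Div G M \<Delta>) = carrier G"
    and lattice_leR: "lattice \<lparr>carrier = carrier G, eq = (=), le = leR G M\<rparr>"

definition parabolic_substructure ::
  "('a, 'b) monoid_scheme \<Rightarrow> 'a set \<Rightarrow> 'a \<Rightarrow> 'a set \<Rightarrow> 'a set \<Rightarrow> 'a \<Rightarrow> bool" where
  "parabolic_substructure G M \<Delta> H N \<delta> \<longleftrightarrow>
     \<delta> \<in> M \<and> balanced G M \<delta> \<and>
     H = generate G (Div G M \<delta>) \<and>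
     N = submonoid_gen G (Div G M \<delta>) \<and>
     Div G M \<delta> = Div G M \<Delta> \<inter> N"

definition unmovable :: "('a, 'b) monoid_scheme \<Rightarrow> 'a set \<Rightarrow> 'a \<Rightarrow> 'a \<Rightarrow> bool" where
  "unmovable G M \<Delta> a \<longleftrightarrow> a \<in> M \<and> \<not> leR G M \<Delta> a"

definition tail :: "('a, 'b) monoid_scheme \<Rightarrow> 'a set \<Rightarrow> 'a set \<Rightarrow> 'a \<Rightarrow> 'a" where
  "tail G M K a = (THE b. b \<in> K \<and> {c \<in> K. leR G M c a} = {c \<in> K. leR G M c b})"

text \<open>
  The list \<open>[a\<^sub>1, \<dots>, a\<^sub>p]\<close> encodes the decomposition \<open>a = a\<^sub>p \<cdots> a\<^sub>2 a\<^sub>1\<close>. The list index \<open>j\<close>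
  stands for the index \<open>i = j + 1\<close>, so even \<open>j\<close> belong to \<open>M1\<close> and odd \<open>j\<close> to \<open>N\<close>, and
  \<open>a\<^sub>p \<cdots> a\<^sub>i\<close> is the product of \<open>rev (drop j xs)\<close>.\<close>

definition alternating_form ::
  "('a, 'b) monoid_scheme \<Rightarrow> 'a set \<Rightarrow> 'a set \<Rightarrow> 'a set \<Rightarrow> 'a \<Rightarrow> 'a list \<Rightarrow> bool" where
  "alternating_form G M N M1 a xs \<longleftrightarrow>
     xs \<noteq> [] \<and> set xs \<subseteq> M \<and> last xs \<noteq> \<one>\<^bsub>G\<^esub> \<and>
     a = prod_of_list G (rev xs) \<and>
     (\<forall>j < length xs.
        xs ! j = tail G M (if even j then M1 else N) (prod_of_list G (rev (drop j xs))))"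

definition breadth ::
  "('a, 'b) monoid_scheme \<Rightarrow> 'a set \<Rightarrow> 'a set \<Rightarrow> 'a set \<Rightarrow> 'a \<Rightarrow> nat" where
  "breadth G M N M1 a =
     (if a = \<one>\<^bsub>G\<^esub> then 1
      else (THE p. \<exists>xs. alternating_form G M N M1 a xs \<and> length xs = p))"

definition depth ::
  "('a, 'b) monoid_scheme \<Rightarrow> 'a set \<Rightarrow> 'a set \<Rightarrow> 'a set \<Rightarrow> 'a \<Rightarrow> nat" where
  "depth G M N M1 a =
     (if odd (breadth G M N M1 a) then (breadth G M N M1 a - 1) div 2
      else breadth G M N M1 a div 2)"

text \<open>
  The relative notions for the pair \<open>(H, G1)\<close> depend on it only through the parabolic
  submonoids \<open>N\<close> and \<open>M1\<close>.\<close>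

definition negative_elements ::
  "('a, 'b) monoid_scheme \<Rightarrow> 'a set \<Rightarrow> 'a \<Rightarrow> 'a set \<Rightarrow> 'a set \<Rightarrow> 'a set" where
  "negative_elements G M \<Delta> N M1 =
     {\<alpha> \<in> carrier G. \<exists>a (k::nat).
        unmovable G M \<Delta> a \<and> \<alpha> = a \<otimes>\<^bsub>G\<^esub> \<Delta> [^]\<^bsub>G\<^esub> (- int k) \<and> k \<ge> 1 \<and>
        depth G M N M1 a < depth G M N M1 (\<Delta> [^]\<^bsub>G\<^esub> k)}"

definition positive_elements ::
  "('a, 'b) monoid_scheme \<Rightarrow> 'a set \<Rightarrow> 'a \<Rightarrow> 'a set \<Rightarrow> 'a set \<Rightarrow> 'a set" where
  "positive_elements G M \<Delta> N M1 =
     {\<alpha> \<in> carrier G. inv\<^bsub>G\<^esub> \<alpha> \<in> negative_elements G M \<Delta> N M1}"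

definition dehornoy_setting ::
  "('a, 'b) monoid_scheme \<Rightarrow> 'a set \<Rightarrow> 'a \<Rightarrow> 'a set \<Rightarrow> 'a set \<Rightarrow> 'a \<Rightarrow> 'a set \<Rightarrow> 'a set \<Rightarrow> 'a \<Rightarrow> bool"
  where
  "dehornoy_setting G M \<Delta> H N \<Lambda> G1 M1 \<Delta>1 \<longleftrightarrow>
     garside_structure G M \<Delta> \<and>
     parabolic_substructure G M \<Delta> H N \<Lambda> \<and>
     parabolic_substructure G M \<Delta> G1 M1 \<Delta>1 \<and>
     N \<noteq> M \<and> M1 \<noteq> M \<and>
     submonoid_gen G (N \<union> M1) = M \<and>
     (\<forall>g \<in> carrier G. \<Delta> \<otimes>\<^bsub>G\<^esub> g = g \<otimes>\<^bsub>G\<^esub> \<Delta>) \<and>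
     (\<forall>g \<in> G1. \<Delta>1 \<otimes>\<^bsub>G\<^esub> g = g \<otimes>\<^bsub>G\<^esub> \<Delta>1)"

definition dehornoy_structure ::
  "('a, 'b) monoid_scheme \<Rightarrow> 'a set \<Rightarrow> 'a \<Rightarrow> 'a set \<Rightarrow> 'a set \<Rightarrow> 'a \<Rightarrow> 'a set \<Rightarrow> 'a set \<Rightarrow> 'a \<Rightarrow> bool"
  where
  "dehornoy_structure G M \<Delta> H N \<Lambda> G1 M1 \<Delta>1 \<longleftrightarrow>
     dehornoy_setting G M \<Delta> H N \<Lambda> G1 M1 \<Delta>1 \<and>
     (let P = positive_elements G M \<Delta> N M1 in
        P <#>\<^bsub>G\<^esub> P \<subseteq> P \<and>
        G1 <#>\<^bsub>G\<^esub> P <#>\<^bsub>G\<^esub> G1 \<subseteq> P \<and>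
        carrier G = P \<union> set_inv\<^bsub>G\<^esub> P \<union> G1 \<and>
        P \<inter> set_inv\<^bsub>G\<^esub> P = {} \<and> P \<inter> G1 = {} \<and> set_inv\<^bsub>G\<^esub> P \<inter> G1 = {})"

end

theory Submission
  imports Defs
begin

text \<open>
  Call a subset \<open>P\<close> of a group \<open>K\<close> a positive cone relative to a subgroup \<open>L\<close> if it behaves like the
  positive elements of a Dehornoy structure: \<open>PP \<subseteq> P\<close>, \<open>LPL \<subseteq> P\<close>, and \<open>K\<close> is the disjoint union of
  \<open>P\<close>, \<open>P\<^sup>-\<^sup>1\<close> and \<open>L\<close>. Relative cones are stable under inversion and compose along chains
  \<open>J \<subseteq> L \<subseteq> K\<close> by taking unions, and a cone relative to the trivial subgroup is the positive
  cone of a left-order. Only the group-theoretic axioms (a), (b), (c) of a Dehornoy structure matter.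
\<close>

definition relative_cone :: "('a, 'b) monoid_scheme \<Rightarrow> 'a set \<Rightarrow> 'a set \<Rightarrow> 'a set \<Rightarrow> bool" where
  "relative_cone G K L P \<longleftrightarrow>
     P \<subseteq> K \<and>
     (\<forall>x\<in>P. \<forall>y\<in>P. x \<otimes>\<^bsub>G\<^esub> y \<in> P) \<and>
     (\<forall>g\<in>L. \<forall>x\<in>P. \<forall>h\<in>L. g \<otimes>\<^bsub>G\<^esub> x \<otimes>\<^bsub>G\<^esub> h \<in> P) \<and>
     (\<forall>x\<in>K. x \<in> P \<or> inv\<^bsub>G\<^esub> x \<in> P \<or> x \<in> L) \<and>
     (\<forall>x\<in>P. inv\<^bsub>G\<^esub> x \<notin> P \<and> x \<notin> L)"

section \<open>Relative cones: inversion and composition along a chain\<close>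

context group
begin

lemma mem_set_inv_iff:
  assumes "P \<subseteq> carrier G"
  shows "x \<in> set_inv P \<longleftrightarrow> x \<in> carrier G \<and> inv x \<in> P"
proof
  assume "x \<in> set_inv P"
  then show "x \<in> carrier G \<and> inv x \<in> P"
    using assms by (auto simp: SET_INV_def)
next
  assume "x \<in> carrier G \<and> inv x \<in> P"
  then show "x \<in> set_inv P"
    unfolding SET_INV_def by (metis (no_types, lifting) UN_iff insertI1 inv_inv)
qed

lemma relative_cone_refl: "relative_cone G K K {}"
  by (simp add: relative_cone_def)

text \<open>This takes care of a sign -1. The conditions are symmetric under exchanging
  \<open>P\<close> with its set of inverses: inversion only reverses the order of the factors, and a
  subgroup \<open>L\<close> is stable under it, so \<open>inv (g \<otimes> x \<otimes> h)\<close> is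
  again an element of \<open>inv P\<close> or \<open>P\<close> between two elements of
  \<open>L\<close>.\<close>

lemma relative_cone_set_inv:
  assumes K: "subgroup K G" and L: "subgroup L G" and P: "relative_cone G K L P"
  shows "relative_cone G K L (set_inv P)"
proof -
  have KG: "K \<subseteq> carrier G" and LG: "L \<subseteq> carrier G"
    using K L by (auto dest: subgroup.subset)
  have PK: "P \<subseteq> K" using P by (simp add: relative_cone_def)
  have iff: "x \<in> set_inv P \<longleftrightarrow> x \<in> carrier G \<and> inv x \<in> P" for x
    using PK KG by (intro mem_set_inv_iff) blast
  have sub: "set_inv P \<subseteq> K"
  proof
    fix x assume "x \<in> set_inv P"
    then have "x \<in> carrier G" "inv x \<in> K" using iff PK by auto
    then show "x \<in> K" using subgroup.m_inv_closed[OF K, of "inv x"] by simp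
  qed
  have mult: "x \<otimes> y \<in> set_inv P" if "x \<in> set_inv P" "y \<in> set_inv P" for x y
    using that P by (auto simp: iff inv_mult_group relative_cone_def)
  have sandwich: "g \<otimes> x \<otimes> h \<in> set_inv P" if "g \<in> L" "x \<in> set_inv P" "h \<in> L" for g x h
  proof -
    have mem: "g \<in> carrier G" "x \<in> carrier G" "h \<in> carrier G" "inv x \<in> P"
      using that LG iff by auto
    have "inv h \<otimes> inv x \<otimes> inv g \<in> P"
      using P mem that subgroup.m_inv_closed[OF L] by (simp add: relative_cone_def)
    then show ?thesis using mem by (simp add: iff inv_mult_group m_assoc)
  qed
  have total: "x \<in> set_inv P \<or> inv x \<in> set_inv P \<or> x \<in> L" if "x \<in> K" for x
  proof -
    have "x \<in> carrier G" "inv (inv x) = x" using that KG by auto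
    moreover have "x \<in> P \<or> inv x \<in> P \<or> x \<in> L" using that P by (simp add: relative_cone_def)
    ultimately show ?thesis by (auto simp: iff)
  qed
  have disj: "inv x \<notin> set_inv P \<and> x \<notin> L" if "x \<in> set_inv P" for x
  proof -
    have x: "x \<in> carrier G" "inv x \<in> P" using that iff by auto
    then have "x \<notin> P" "inv x \<notin> L" using P by (force simp: relative_cone_def)+
    then show ?thesis using x subgroup.m_inv_closed[OF L] by (auto simp: iff)
  qed
  show ?thesis
    using sub mult sandwich total disj by (simp add: relative_cone_def)
qed

lemma relative_cone_sign_set:
  assumes "subgroup K G" and "subgroup L G" and "relative_cone G K L P"
  shows "relative_cone G K L (sign_set G P e)"
  using assms relative_cone_set_inv by (simp add: sign_set_def)

text \<open>An element of \<open>K\<close> outside \<open>P\<close> and its inverses lies in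
  \<open>L\<close>, where \<open>Q\<close> decides. Since \<open>Q\<close> is contained in
  \<open>L\<close> and \<open>P\<close> absorbs factors from \<open>L\<close> on both sides, a mixed
  product of an element of \<open>P\<close> and one of \<open>Q\<close> falls into
  \<open>P\<close>.\<close>

lemma relative_cone_trans:
  assumes K: "subgroup K G" and L: "subgroup L G" and LK: "L \<subseteq> K" and JL: "J \<subseteq> L"
    and P: "relative_cone G K L P" and Q: "relative_cone G L J Q"
  shows "relative_cone G K J (P \<union> Q)"
proof -
  have KG: "K \<subseteq> carrier G" using K by (rule subgroup.subset)
  have PK: "P \<subseteq> K" and QL: "Q \<subseteq> L" using P Q by (auto simp: relative_cone_def)
  have sandwich: "g \<otimes> x \<otimes> h \<in> P" if "g \<in> L" "x \<in> P" "h \<in> L" for g x h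
    using P that by (simp add: relative_cone_def)
  \<comment> \<open>Putting \<open>\<one>\<close> on one side of the sandwich yields absorption on
    the left and on the right separately.\<close>
  have "\<one> \<in> L" using L by (rule subgroup.one_closed)
  then have LP: "g \<otimes> x \<in> P" and PL: "x \<otimes> g \<in> P" if "g \<in> L" "x \<in> P" for g x
    using that sandwich[of g x \<one>] sandwich[of \<one> x g] PK KG LK by (auto simp: subset_iff)
  have sub: "P \<union> Q \<subseteq> K" using PK QL LK by blast
  have mult: "x \<otimes> y \<in> P \<union> Q" if "x \<in> P \<union> Q" "y \<in> P \<union> Q" for x y
    using that P Q LP PL QL by (auto simp: relative_cone_def)
  have sandwich': "g \<otimes> x \<otimes> h \<in> P \<union> Q" if "g \<in> J" "x \<in> P \<union> Q" "h \<in> J" for g x h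
    using that sandwich Q JL by (auto simp: relative_cone_def)
  have total: "x \<in> P \<union> Q \<or> inv x \<in> P \<union> Q \<or> x \<in> J" if "x \<in> K" for x
    using that P Q by (auto simp: relative_cone_def)
  have disj: "inv x \<notin> P \<union> Q \<and> x \<notin> J" if "x \<in> P \<union> Q" for x
  proof -
    \<comment> \<open>An element and its inverse lie in \<open>L\<close> together or not at all. As
      \<open>P\<close> avoids \<open>L\<close> and \<open>Q\<close> lies in \<open>L\<close>, an
      element of one set cannot have its inverse in the other.\<close>
    have inv_L: "inv x \<in> L \<longleftrightarrow> x \<in> L"
      using that sub KG subgroup.m_inv_closed[OF L] by (metis inv_inv subsetD)
    show ?thesis
      using that P Q QL JL inv_L by (auto simp: relative_cone_def)
  qed
  show ?thesis
    using sub mult sandwich' total disj by (simp add: relative_cone_def)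
qed

text \<open>Induction on the length of the chain: each new link is attached at the lower end by
  transitivity, starting from the empty cone of \<open>K 0\<close> relative to itself.\<close>

lemma relative_cone_UN:
  assumes K: "\<And>i. subgroup (K i) G"
    and mono: "\<And>i. K (Suc i) \<subseteq> K i"
    and P: "\<And>i. i < n \<Longrightarrow> relative_cone G (K i) (K (Suc i)) (P i)"
  shows "relative_cone G (K 0) (K n) (\<Union>i<n. P i)"
  using P
proof (induction n)
  case 0
  then show ?case by (simp add: relative_cone_refl)
next
  case (Suc n)
  have "K n \<subseteq> K 0"
    using lift_Suc_antimono_le[of K 0 n] mono by simp
  moreover have "relative_cone G (K 0) (K n) (\<Union>i<n. P i)"
    using Suc by simp
  ultimately have "relative_cone G (K 0) (K (Suc n)) ((\<Union>i<n. P i) \<union> P n)"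
    using K mono Suc.prems by (intro relative_cone_trans[of "K 0" "K n"]) auto
  then show ?case by (simp add: lessThan_Suc Un_commute)
qed

section \<open>From a cone relative to the trivial subgroup to a left-order\<close>

text \<open>The order puts \<open>a\<close> below \<open>b\<close> when
  \<open>inv a \<otimes> b \<in> P\<close>. Transitivity is closure of \<open>P\<close> under
  products, totality is the covering of the group by \<open>P\<close>, its inverses and
  \<open>\<one>\<close>, and left invariance holds because a common left factor cancels in
  \<open>inv a \<otimes> b\<close>.\<close>

lemma left_order_of_relative_cone:
  assumes P: "relative_cone G (carrier G) {\<one>} P"
  shows "\<exists>r. left_order G r \<and> positive_cone_of G P r"
proof -
  define r where "r = {(a, b). a \<in> carrier G \<and> b \<in> carrier G \<and> inv a \<otimes> b \<in> P}"
  have PG: "P \<subseteq> carrier G"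
    and mult: "\<And>x y. \<lbrakk>x \<in> P; y \<in> P\<rbrakk> \<Longrightarrow> x \<otimes> y \<in> P"
    and total: "\<And>x. x \<in> carrier G \<Longrightarrow> x \<in> P \<or> inv x \<in> P \<or> x = \<one>"
    and disj: "\<And>x. x \<in> P \<Longrightarrow> inv x \<notin> P" and one: "\<one> \<notin> P"
    using P by (auto simp: relative_cone_def)
  note iff = mem_set_inv_iff[OF PG]
  have "trans r"
  proof (rule transI)
    fix a b c assume "(a, b) \<in> r" "(b, c) \<in> r"
    then have mem: "a \<in> carrier G" "b \<in> carrier G" "c \<in> carrier G"
      and "inv a \<otimes> b \<in> P" "inv b \<otimes> c \<in> P"
      by (auto simp: r_def)
    then have "(inv a \<otimes> b) \<otimes> (inv b \<otimes> c) \<in> P" using mult by simp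
    moreover have "(inv a \<otimes> b) \<otimes> (inv b \<otimes> c) = inv a \<otimes> c"
      using mem by (metis inv_closed inv_solve_left m_assoc m_closed)
    ultimately show "(a, c) \<in> r" using mem by (simp add: r_def)
  qed
  moreover have "irrefl r"
    using one by (auto simp: irrefl_def r_def)
  moreover have "total_on (carrier G) r"
  proof (rule total_onI)
    fix a b assume mem: "a \<in> carrier G" "b \<in> carrier G" and "a \<noteq> b"
    then have "inv a \<otimes> b \<noteq> \<one>" by (metis inv_equality inv_inv inv_closed)
    moreover have "inv (inv a \<otimes> b) = inv b \<otimes> a" using mem by (simp add: inv_mult_group)
    ultimately show "(a, b) \<in> r \<or> (b, a) \<in> r"
      using total[of "inv a \<otimes> b"] mem by (auto simp: r_def)
  qed
  moreover have "(c \<otimes> a, c \<otimes> b) \<in> r" if "(a, b) \<in> r" "c \<in> carrier G" for a b c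
  proof -
    have mem: "a \<in> carrier G" "b \<in> carrier G" using that by (auto simp: r_def)
    then have "inv (c \<otimes> a) \<otimes> (c \<otimes> b) = inv a \<otimes> b"
      using that(2) by (metis inv_closed inv_mult_group inv_solve_left m_assoc m_closed)
    then show ?thesis using that mem by (simp add: r_def)
  qed
  ultimately have "left_order G r"
    by (auto simp: left_order_def strict_linear_order_on_def r_def)
  moreover have "positive_cone_of G P r"
    unfolding positive_cone_of_def
  proof (intro conjI)
    show "P <#> P \<subseteq> P" using mult by (auto simp: set_mult_def)
    show "carrier G = P \<union> set_inv P \<union> {\<one>}" using total PG iff by auto
    show "P \<inter> set_inv P = {}" using disj iff by auto
    show "set_inv P \<inter> {\<one>} = {}" using one iff by auto
  qed (use PG one in \<open>auto simp: r_def\<close>)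
  ultimately show ?thesis by blast
qed

section \<open>The two sources of relative cones: infinite cyclic groups and Dehornoy
  structures\<close>

lemma relative_cone_infinite_cyclic:
  assumes a: "a \<in> carrier G" and inf: "infinite (generate G {a})"
  shows "relative_cone G (generate G {a}) {\<one>} {a [^] k | k::nat. k \<ge> 1}"
    (is "relative_cone G ?K _ ?P")
proof -
  \<comment> \<open>The order of \<open>a\<close> is the cardinality of the subgroup it generates,
    and \<open>card\<close> of an infinite set is \<open>0\<close>. Then
    \<open>a [^] k = \<one>\<close> means that \<open>0\<close> divides \<open>k\<close>, which
    forces \<open>k = 0\<close>.\<close>
  have "ord a = 0"
    using generate_pow_card[OF a] inf by simp
  then have pow_eq_one: "a [^] k = \<one> \<longleftrightarrow> k = 0" for k :: nat
    using pow_eq_id[OF a, of k] by simp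
  have K: "?K = {a [^] k | k::int. True}"
    using generate_pow[OF a] by auto
  have sub: "?P \<subseteq> ?K"
    unfolding K by (auto simp: int_pow_int[symmetric])
  have mult: "x \<otimes> y \<in> ?P" if "x \<in> ?P" "y \<in> ?P" for x y
  proof -
    obtain k l :: nat where "x = a [^] k" "y = a [^] l" "k \<ge> 1" "l \<ge> 1"
      using \<open>x \<in> ?P\<close> \<open>y \<in> ?P\<close> by blast
    then have "x \<otimes> y = a [^] (k + l)" "k + l \<ge> 1" using a by (auto simp: nat_pow_mult)
    then show ?thesis by blast
  qed
  have total: "x \<in> ?P \<or> inv x \<in> ?P \<or> x = \<one>" if "x \<in> ?K" for x
  proof -
    obtain k :: int where k: "x = a [^] k" using \<open>x \<in> ?K\<close> K by blast
    show ?thesis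
    proof (cases k rule: int_cases3)
      case zero
      then show ?thesis using k by simp
    next
      case (pos m)
      then have "x = a [^] m" "m \<ge> 1" using k by (simp_all add: int_pow_int)
      then show ?thesis by blast
    next
      case (neg m)
      then have "inv x = a [^] m"
        using k a int_pow_neg[OF a, of "int m"] by (simp add: int_pow_int)
      moreover have "m \<ge> 1" using neg by simp
      ultimately show ?thesis by blast
    qed
  qed
  have one: "\<one> \<notin> ?P"
  proof
    assume "\<one> \<in> ?P"
    then obtain k :: nat where k: "\<one> = a [^] k" "k \<ge> 1" by blast
    then show False using pow_eq_one[of k] by simp
  qed
  \<comment> \<open>If \<open>x\<close> and \<open>inv x\<close> were both positive powers of
    \<open>a\<close>, so would be their product \<open>\<one>\<close>.\<close>
  have inv: "inv x \<notin> ?P" if "x \<in> ?P" for x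
  proof
    assume "inv x \<in> ?P"
    then have "x \<otimes> inv x \<in> ?P" using mult that by blast
    moreover have "x \<in> carrier G" using that a by blast
    ultimately show False using one by simp
  qed
  show ?thesis
    unfolding relative_cone_def
  proof (intro conjI ballI)
    fix g x h assume "g \<in> {\<one>}" "x \<in> ?P" "h \<in> {\<one>}"
    moreover have "x \<in> carrier G" using \<open>x \<in> ?P\<close> a by blast
    ultimately show "g \<otimes> x \<otimes> h \<in> ?P" by simp
  next
    fix x assume "x \<in> ?K"
    then show "x \<in> ?P \<or> inv x \<in> ?P \<or> x \<in> {\<one>}" using total by blast
  next
    fix x assume "x \<in> ?P"
    then show "x \<notin> {\<one>}" using one by blast
  qed (use sub mult inv in blast)+
qed

text \<open>Transfers axioms (a), (b), (c) from the group with carrier \<open>K\<close> to the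
  ambient group \<open>G\<close>, so that all links of the chain live in one group. Products are the
  same in both, and \<open>m_inv_consistent\<close> identifies the inverses of elements of
  \<open>K\<close>. The definition of positivity through depth stays opaque, apart from giving
  \<open>P \<subseteq> K\<close>.\<close>

lemma relative_cone_of_dehornoy_structure:
  assumes K: "subgroup K G"
    and D: "dehornoy_structure (G\<lparr>carrier := K\<rparr>) M \<Delta> H N \<Lambda> L M1 \<Delta>1"
  shows "relative_cone G K L (positive_elements (G\<lparr>carrier := K\<rparr>) M \<Delta> N M1)"
proof -
  let ?K = "G\<lparr>carrier := K\<rparr>"
  define P where "P = positive_elements ?K M \<Delta> N M1"
  interpret K: group ?K using K by (rule subgroup_imp_group)
  have PK: "P \<subseteq> K" by (auto simp: P_def positive_elements_def)
  have mult: "P <#>\<^bsub>?K\<^esub> P \<subseteq> P" and sandwich: "L <#>\<^bsub>?K\<^esub> P <#>\<^bsub>?K\<^esub> L \<subseteq> P"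
    and total: "K = P \<union> set_inv\<^bsub>?K\<^esub> P \<union> L"
    and disj: "P \<inter> set_inv\<^bsub>?K\<^esub> P = {}" "P \<inter> L = {}"
    using D by (auto simp: dehornoy_structure_def Let_def P_def)
  have iff: "x \<in> set_inv\<^bsub>?K\<^esub> P \<longleftrightarrow> inv x \<in> P" if "x \<in> K" for x
    using that PK K.mem_set_inv_iff[of P x] m_inv_consistent[OF K] by simp
  show ?thesis
    unfolding P_def[symmetric] relative_cone_def
  proof (intro conjI ballI)
    fix g x h assume "g \<in> L" "x \<in> P" "h \<in> L"
    then show "g \<otimes> x \<otimes> h \<in> P"
      using sandwich by (fastforce simp: set_mult_def)
  next
    fix x y assume "x \<in> P" "y \<in> P"
    then show "x \<otimes> y \<in> P" using mult by (auto simp: set_mult_def)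
  next
    fix x assume "x \<in> K"
    then show "x \<in> P \<or> inv x \<in> P \<or> x \<in> L" using total iff by blast
  next
    fix x assume "x \<in> P"
    then show "inv x \<notin> P" using disj PK iff by blast
  next
    fix x assume "x \<in> P"
    then show "x \<notin> L" using disj by blast
  qed (rule PK)
qed

end

section \<open>Assembling the chain of parabolic subgroups\<close>

theorem proposition3p1:
  fixes G :: "('a, 'b) monoid_scheme"
    and M :: "'a set" and \<Delta> :: 'a
    and n :: nat
    and Gs Ms Hs Ns :: "nat \<Rightarrow> 'a set"
    and \<Delta>s \<Lambda>s :: "nat \<Rightarrow> 'a"
    and P :: "nat \<Rightarrow> 'a set"
    and \<alpha> :: 'a
    and \<epsilon> :: "nat \<Rightarrow> int"
  assumes garside: "garside_structure G M \<Delta>"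
    and n: "n \<ge> 1"
    and start: "Gs 0 = carrier G" "Ms 0 = M" "\<Delta>s 0 = \<Delta>"
    and parabolic_Gs: "\<And>i. i \<in> {1..n} \<Longrightarrow> parabolic_substructure G M \<Delta> (Gs i) (Ms i) (\<Delta>s i)"
    and parabolic_Hs: "\<And>i. i \<in> {1..n} \<Longrightarrow> parabolic_substructure G M \<Delta> (Hs i) (Ns i) (\<Lambda>s i)"
    and subset: "\<And>i. i < n \<Longrightarrow> Gs (Suc i) \<subseteq> Gs i \<and> Hs (Suc i) \<subseteq> Gs i"
    and dehornoy: "\<And>i. i < n \<Longrightarrow>
          dehornoy_structure (G\<lparr>carrier := Gs i\<rparr>) (Ms i) (\<Delta>s i)
            (Hs (Suc i)) (Ns (Suc i)) (\<Lambda>s (Suc i))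
            (Gs (Suc i)) (Ms (Suc i)) (\<Delta>s (Suc i))"
    and last_iso: "G\<lparr>carrier := Gs n\<rparr> \<cong> integer_group"
    and P_less: "\<And>i. i < n \<Longrightarrow>
          P i = positive_elements (G\<lparr>carrier := Gs i\<rparr>) (Ms i) (\<Delta>s i) (Ns (Suc i)) (Ms (Suc i))"
    and generator: "\<alpha> \<in> Gs n" "generate G {\<alpha>} = Gs n"
    and P_last: "P n = {\<alpha> [^]\<^bsub>G\<^esub> k | k::nat. k \<ge> 1}"
    and signs: "\<And>i. i \<le> n \<Longrightarrow> \<epsilon> i \<in> {1, -1}"
  shows "disjoint_family_on (\<lambda>i. sign_set G (P i) (\<epsilon> i)) {..n} \<and>
         (\<exists>r. left_order G r \<and> positive_cone_of G (\<Union>i\<le>n. sign_set G (P i) (\<epsilon> i)) r)"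
proof -
  note Gs_mono = subset
  interpret garside_structure G M \<Delta> by (rule garside)
  \<comment> \<open>The chain is prolonged by the trivial group, so that \<open>P n\<close> becomes
    the cone of one more link, from \<open>Gs n\<close> down to the identity. The constant tail
    makes \<open>K\<close> a decreasing sequence of subgroups for every index.\<close>
  define K where "K i = (if i \<le> n then Gs i else {\<one>\<^bsub>G\<^esub>})" for i
  have Gs: "subgroup (Gs i) G" if "i \<le> n" for i
  proof (cases "i = 0")
    case True
    then show ?thesis using start subgroup_self by simp
  next
    case False
    then have "parabolic_substructure G M \<Delta> (Gs i) (Ms i) (\<Delta>s i)"
      using parabolic_Gs[of i] that by simp
    then have "Gs i = generate G (Div G M (\<Delta>s i))"
      unfolding parabolic_substructure_def by blast
    moreover have "Div G M (\<Delta>s i) \<subseteq> carrier G"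
      using submonoid.subset[OF submonoid_axioms] unfolding Div_def by blast
    ultimately show ?thesis using generate_is_subgroup by simp
  qed
  have K: "subgroup (K i) G" for i
    using Gs triv_subgroup by (simp add: K_def)
  have mono: "K (Suc i) \<subseteq> K i" for i
  proof (cases "i < n")
    case True
    then show ?thesis using Gs_mono by (simp add: K_def)
  next
    case False
    then have "K (Suc i) = {\<one>\<^bsub>G\<^esub>}" by (simp add: K_def)
    then show ?thesis using subgroup.one_closed[OF K] by simp
  qed
  have "infinite (Gs n)"
  proof -
    obtain h where "h \<in> iso (G\<lparr>carrier := Gs n\<rparr>) integer_group"
      using last_iso by (auto simp: is_iso_def)
    then have "bij_betw h (Gs n) UNIV" by (simp add: iso_def)
    then show ?thesis using bij_betw_finite infinite_UNIV_int by blast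
  qed
  then have "relative_cone G (Gs n) {\<one>\<^bsub>G\<^esub>} (P n)"
    using relative_cone_infinite_cyclic[of \<alpha>] generator P_last subgroup.mem_carrier[OF Gs, of n \<alpha>]
    by simp
  moreover have "relative_cone G (Gs i) (Gs (Suc i)) (P i)" if "i < n" for i
    using relative_cone_of_dehornoy_structure[OF Gs dehornoy] P_less that by simp
  ultimately have "relative_cone G (K i) (K (Suc i)) (P i)" if "i < Suc n" for i
    using that by (cases "i = n") (auto simp: K_def)
  then have cone: "relative_cone G (K i) (K (Suc i)) (sign_set G (P i) (\<epsilon> i))"
    if "i < Suc n" for i
    using that K relative_cone_sign_set by blast
  \<comment> \<open>There are \<open>Suc n\<close> links, and the last one ends in the trivial
    group; hence the union includes the index \<open>n\<close>.\<close>
  have "relative_cone G (K 0) (K (Suc n)) (\<Union>i<Suc n. sign_set G (P i) (\<epsilon> i))"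
    using K mono cone by (rule relative_cone_UN)
  then have "relative_cone G (carrier G) {\<one>\<^bsub>G\<^esub>} (\<Union>i\<le>n. sign_set G (P i) (\<epsilon> i))"
    using start by (simp add: K_def lessThan_Suc_atMost)
  moreover have "disjoint_family_on (\<lambda>i. sign_set G (P i) (\<epsilon> i)) {..n}"
  proof -
    have disj: "sign_set G (P i) (\<epsilon> i) \<inter> sign_set G (P j) (\<epsilon> j) = {}" if "i < j" "j \<le> n" for i j
    proof -
      \<comment> \<open>The set at index \<open>j\<close> lies in \<open>K j\<close>, hence in
        \<open>K (Suc i)\<close>, which the set at the smaller index \<open>i\<close>
        avoids.\<close>
      have "K j \<subseteq> K (Suc i)"
        using lift_Suc_antimono_le[of K] mono that by simp
      then show ?thesis
        using cone[of i] cone[of j] that by (auto simp: relative_cone_def)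
    qed
    show ?thesis
      unfolding disjoint_family_on_def using disj by (metis Int_commute atMost_iff nat_neq_iff)
  qed
  ultimately show ?thesis using left_order_of_relative_cone by blast
qed

end
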